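(* Let $(\mathcal X,\langle\cdot,\cdot\rangle)$ be a complex inner-product space and $\mathbb A:\mathcal X\to\mathcal X$ a bijective linear operator. Let $\boldsymbol\psi_1,\dots,\boldsymbol\psi_m\in\mathcal X$ be linearly independent and let $P:\mathbb C^m\to\mathcal X$, $P\mathbf v:=\sum_{k=1}^m(\mathbf v)_k\boldsymbol\psi_k$, and $R:\mathcal X\to\mathbb C^m$, $R\mathbf f:=[\langle\boldsymbol\psi_1,\mathbf f\rangle,\dots,\langle\boldsymbol\psi_m,\mathbf f\rangle]^\top$. Assume that $\mathbb A_c:=R\mathbb AP\in\mathbb C^{m\times m}$ is invertible. Then for any $\boldsymbol\psi\in\mathcal X$, $$[\mathbb I-P\mathbb A_c^{-1}R\mathbb A]\boldsymbol\psi=0\iff\boldsymbol\psi\in V_c:=\mathrm{span}\{\boldsymbol\psi_1,\dots,\boldsymbol\psi_m\}.$$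
   Context: $\mathbb I$ is the identity on $\mathcal X$. The inner product is taken linear in its second argument, so that $R$ is linear. *)

theory Defs
  imports "HOL-Analysis.Analysis"
begin

text \<open>
  HOL-Analysis only provides real inner-product spaces, hence this class. The inner product is
  linear in its second argument (and so conjugate-linear in the first); no completeness or
  finite-dimensionality is assumed. That \<open>cinner x x\<close> is real follows from conjugate symmetry.
\<close>

class complex_inner_space = ab_group_add +
  fixes scaleC :: "complex \<Rightarrow> 'a \<Rightarrow> 'a"  (infixr "*\<^sub>C" 75)
    and cinner :: "'a \<Rightarrow> 'a \<Rightarrow> complex"
  assumes scaleC_add_right: "c *\<^sub>C (x + y) = c *\<^sub>C x + c *\<^sub>C y"
    and scaleC_add_left: "(c + d) *\<^sub>C x = c *\<^sub>C x + d *\<^sub>C x"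
    and scaleC_scaleC: "c *\<^sub>C (d *\<^sub>C x) = (c * d) *\<^sub>C x"
    and scaleC_one: "1 *\<^sub>C x = x"
    and cinner_commute: "cinner x y = cnj (cinner y x)"
    and cinner_add_right: "cinner x (y + z) = cinner x y + cinner x z"
    and cinner_scaleC_right: "cinner x (c *\<^sub>C y) = c * cinner x y"
    and cinner_ge_zero: "0 \<le> Re (cinner x x)"
    and cinner_eq_zero_iff: "cinner x x = 0 \<longleftrightarrow> x = 0"

text \<open>Makes the library's linear algebra available over the complex scalars, as \<open>cspan\<close>, \<open>cdependent\<close>
  and the facts prefixed \<open>complex_vector\<close>.\<close>

global_interpretation complex_vector: vector_space "scaleC :: complex \<Rightarrow> 'a \<Rightarrow> 'a::complex_inner_space"
  defines dependent_complex_def: cdependent = complex_vector.dependent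
    and span_complex_def: cspan = complex_vector.span
  by unfold_locales
    (simp_all add: scaleC_add_right scaleC_add_left scaleC_scaleC scaleC_one)

abbreviation clinear :: "('a::complex_inner_space \<Rightarrow> 'b::complex_inner_space) \<Rightarrow> bool"
  where "clinear \<equiv> Vector_Spaces.linear scaleC scaleC"

text \<open>
  Linear independence of an indexed family: the library's \<open>dependent\<close> is a predicate on sets
  and cannot see repetitions, so injectivity has to be required separately.
\<close>

definition cindependent_family :: "('m \<Rightarrow> 'a::complex_inner_space) \<Rightarrow> bool"
  where "cindependent_family \<psi> \<longleftrightarrow> inj \<psi> \<and> \<not> cdependent (range \<psi>)"

definition prolongation :: "('m::finite \<Rightarrow> 'a::complex_inner_space) \<Rightarrow> complex ^ 'm \<Rightarrow> 'a"
  where "prolongation \<psi> v = (\<Sum>k\<in>UNIV. (v $ k) *\<^sub>C \<psi> k)"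

definition restriction :: "('m::finite \<Rightarrow> 'a::complex_inner_space) \<Rightarrow> 'a \<Rightarrow> complex ^ 'm"
  where "restriction \<psi> f = (\<chi> k. cinner (\<psi> k) f)"

text \<open>
  The operator \<open>R A P\<close> on \<open>complex ^ 'm\<close>, as a matrix in the standard basis; its entry at row \<open>i\<close>,
  column \<open>j\<close> is \<open>cinner (\<psi> i) (A (\<psi> j))\<close>.
\<close>

definition coarse_matrix ::
  "('m::finite \<Rightarrow> 'a::complex_inner_space) \<Rightarrow> ('a \<Rightarrow> 'a) \<Rightarrow> complex ^ 'm ^ 'm"
  where "coarse_matrix \<psi> A = matrix (restriction \<psi> \<circ> A \<circ> prolongation \<psi>)"

end

theory Submission imports Defs begin

text \<open>
  Write \<open>P\<close>, \<open>R\<close> for the prolongation and the restriction and \<open>M = R A P\<close> for the coarse matrix.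
  The operator \<open>Q = P M\<inverse> R A\<close> is the projection onto the coarse space along the kernel of
  \<open>R A\<close>: every value of \<open>Q\<close> lies in the range of \<open>P\<close>, and \<open>Q\<close> fixes that range because
  \<open>Q (P v) = P (M\<inverse> (M v)) = P v\<close>. So \<open>f - Q f = 0\<close> holds exactly for \<open>f\<close> in the range of \<open>P\<close>.
  Two facts make this precise: the range of \<open>P\<close> is the span of the basis vectors
  (\<open>range_prolongation\<close>), and multiplication by \<open>M\<close> is \<open>R A P\<close> (\<open>coarse_matrix_mult\<close>).
\<close>

lemma linear_prolongation:
  "Vector_Spaces.linear (*s) scaleC (prolongation \<psi>)"
proof -
  have add: "prolongation \<psi> (v + w) = prolongation \<psi> v + prolongation \<psi> w" for v w
    by (simp add: prolongation_def scaleC_add_left sum.distrib)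
  have scale: "prolongation \<psi> (c *s v) = c *\<^sub>C prolongation \<psi> v" for c v
    by (simp add: prolongation_def complex_vector.scale_sum_right scaleC_scaleC)
  show ?thesis
    by (simp add: Vector_Spaces.linear_iff vec.vector_space_axioms
        complex_vector.vector_space_axioms add scale)
qed

lemma linear_restriction:
  "Vector_Spaces.linear scaleC (*s) (restriction \<psi>)"
  by (simp add: Vector_Spaces.linear_iff vec.vector_space_axioms
      complex_vector.vector_space_axioms restriction_def vec_eq_iff
      cinner_add_right cinner_scaleC_right)

lemma prolongation_axis: "prolongation \<psi> (axis k 1) = \<psi> k"
proof -
  have "prolongation \<psi> (axis k 1) = (\<Sum>j\<in>UNIV. if j = k then \<psi> j else 0)"
    unfolding prolongation_def
    by (rule sum.cong) (auto simp: axis_def scaleC_one)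
  then show ?thesis by simp
qed

text \<open>
  Both inclusions are closure arguments, so no choice of coefficients is needed: a value of the
  prolongation is a linear combination of the family, and its range is a subspace containing every
  \<open>\<psi> k\<close>, the image of the standard basis vector \<open>axis k 1\<close>.
\<close>

lemma range_prolongation: "range (prolongation \<psi>) = cspan (range \<psi>)"
proof
  show "range (prolongation \<psi>) \<subseteq> cspan (range \<psi>)"
    unfolding prolongation_def
    by (intro image_subsetI complex_vector.span_sum complex_vector.span_scale
        complex_vector.span_base rangeI)
next
  interpret P: Vector_Spaces.linear "(*s)" scaleC "prolongation \<psi>"
    by (rule linear_prolongation)
  have "complex_vector.subspace (range (prolongation \<psi>))"
    by (rule P.subspace_image) (rule vec.subspace_UNIV)
  moreover have "range \<psi> \<subseteq> range (prolongation \<psi>)"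
    using prolongation_axis by (metis image_subsetI rangeI)
  ultimately show "cspan (range \<psi>) \<subseteq> range (prolongation \<psi>)"
    by (rule complex_vector.span_minimal[rotated])
qed

lemma coarse_matrix_mult:
  assumes "clinear A"
  shows "coarse_matrix \<psi> A *v v = restriction \<psi> (A (prolongation \<psi> v))"
proof -
  have "Vector_Spaces.linear (*s) (*s) (restriction \<psi> \<circ> A \<circ> prolongation \<psi>)"
    by (intro Vector_Spaces.linear_compose[OF linear_prolongation]
        Vector_Spaces.linear_compose[OF assms] linear_restriction)
  from matrix_works[OF this] show ?thesis
    by (simp add: coarse_matrix_def)
qed

lemma matrix_inv_mult_left:
  fixes M :: "'b::semiring_1 ^ 'n ^ 'm"
  assumes "invertible M"
  shows "matrix_inv M ** M = mat 1"
  using someI_ex[OF assms[unfolded invertible_def]]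
  by (simp add: matrix_inv_def)

theorem theorem4p2:
  fixes A :: "'a::complex_inner_space \<Rightarrow> 'a"
    and \<psi> :: "'m::finite \<Rightarrow> 'a"
    and f :: 'a
  assumes "clinear A"
    and "bij A"
    and "cindependent_family \<psi>"
    and "invertible (coarse_matrix \<psi> A)"
  shows "f - prolongation \<psi> (matrix_inv (coarse_matrix \<psi> A) *v restriction \<psi> (A f)) = 0
    \<longleftrightarrow> f \<in> cspan (range \<psi>)"
proof
  assume "f - prolongation \<psi> (matrix_inv (coarse_matrix \<psi> A) *v restriction \<psi> (A f)) = 0"
  then have "f \<in> range (prolongation \<psi>)"
    by (metis eq_iff_diff_eq_0 rangeI)
  then show "f \<in> cspan (range \<psi>)"
    by (simp only: range_prolongation)
next
  assume "f \<in> cspan (range \<psi>)"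
  then obtain v where f: "f = prolongation \<psi> v"
    by (metis range_prolongation imageE)
  have "matrix_inv (coarse_matrix \<psi> A) *v restriction \<psi> (A f)
      = (matrix_inv (coarse_matrix \<psi> A) ** coarse_matrix \<psi> A) *v v"
    by (simp add: f coarse_matrix_mult[OF assms(1), symmetric] matrix_vector_mul_assoc)
  also have "\<dots> = v"
    by (simp add: matrix_inv_mult_left[OF assms(4)])
  finally show "f - prolongation \<psi> (matrix_inv (coarse_matrix \<psi> A) *v restriction \<psi> (A f)) = 0"
    by (simp add: f)
qed

end
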